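(* Let $\mathbf{Q}$ be a quantale, $\mathbf{M}_1$ a right $\mathbf{Q}$-module and $\mathbf{M}_2$ a left $\mathbf{Q}$-module. Then the tensor product $\mathbf{M}_1\otimes_{\mathbf{Q}}\mathbf{M}_2$ exists; it is, up to isomorphisms, the quotient of the free sup-lattice $\wp(M_1\times M_2)$ (the powerset of $M_1\times M_2$ with union) generated by $M_1\times M_2$ with respect to the sup-lattice congruence generated by the set $R'$ of all pairs of the following three forms: $$\Big(\big\{(\textstyle\bigvee A,\,y)\big\},\ \bigcup_{a\in A}\{(a,y)\}\Big),\qquad \Big(\big\{(x,\textstyle\bigvee B)\big\},\ \bigcup_{b\in B}\{(x,b)\}\Big),\qquad \big(\{(x\star q,\,y)\},\ \{(x,\,q\star y)\}\big),$$ with $A\subseteq M_1$, $B\subseteq M_2$, $x\in M_1$, $y\in M_2$, $q\in Q$.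
   Context: A sup-lattice is a poset with arbitrary joins; sup-lattice homomorphisms preserve arbitrary joins. A quantale $\mathbf{Q}=\langle Q,\vee,\cdot,\bot,e\rangle$ is a sup-lattice with a monoid structure whose product distributes over arbitrary joins in both arguments. A left $\mathbf{Q}$-module is a sup-lattice $\mathbf{M}$ with $\star:Q\times M\to M$ preserving arbitrary joins in each argument, with $(q_1q_2)\star m=q_1\star(q_2\star m)$ and $e\star m=m$; right modules are analogous, with scalars on the right. For a right $\mathbf{Q}$-module $\mathbf{M}_1$, a left $\mathbf{Q}$-module $\mathbf{M}_2$ and a sup-lattice $\mathbf{L}$, a $\mathbf{Q}$-bimorphism $f:M_1\times M_2\to L$ is a map preserving arbitrary joins in each variable separately and satisfying $f(x\star q,y)=f(x,q\star y)$. The tensor product $\mathbf{M}_1\otimes_{\mathbf{Q}}\mathbf{M}_2$ is a sup-lattice equipped with a $\mathbf{Q}$-bimorphism $\tau:M_1\times M_2\to\mathbf{M}_1\otimes_{\mathbf{Q}}\mathbf{M}_2$ such that for every sup-lattice $\mathbf{L}$ and $\mathbf{Q}$-bimorphism $f:M_1\times M_2\to\mathbf{L}$ there is a unique sup-lattice homomorphism $k_f:\mathbf{M}_1\otimes_{\mathbf{Q}}\mathbf{M}_2\to\mathbf{L}$ with $k_f\circ\tau=f$. *)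

theory Defs
  imports "HOL-Algebra.Group"
begin

section \<open>Sup-lattices\<close>

text \<open>
  Orders are the carrier-based ones of HOL-Algebra; the join of \<open>A \<subseteq> carrier L\<close> is
  \<open>\<Squnion>\<^bsub>L\<^esub>A\<close>.  As in the library's \<^locale>\<open>partial_order\<close>, the \<open>eq\<close> field of
  the record is plain equality.
\<close>

locale sup_lattice = partial_order +
  assumes sup_exists:
    "A \<subseteq> carrier L \<Longrightarrow> \<exists>s. least L s (Upper L A)"

definition sup_hom :: "('a, 'c) gorder_scheme \<Rightarrow> ('b, 'd) gorder_scheme \<Rightarrow> ('a \<Rightarrow> 'b) set"
  where "sup_hom L K =
    {f \<in> carrier L \<rightarrow> carrier K. \<forall>A \<subseteq> carrier L. f (\<Squnion>\<^bsub>L\<^esub>A) = \<Squnion>\<^bsub>K\<^esub>(f ` A)}"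

definition sup_iso :: "('a, 'c) gorder_scheme \<Rightarrow> ('b, 'd) gorder_scheme \<Rightarrow> ('a \<Rightarrow> 'b) set"
  where "sup_iso L K = {f \<in> sup_hom L K. bij_betw f (carrier L) (carrier K)}"

definition powerset_lattice :: "'a set \<Rightarrow> 'a set gorder"
  where "powerset_lattice X = \<lparr>carrier = Pow X, eq = (=), le = (\<subseteq>)\<rparr>"

text \<open>
  A set \<open>P \<subseteq> \<theta>\<close> of pairs plays the role of a family of pairs \<open>(x\<^sub>i, y\<^sub>i) \<in> \<theta>\<close>.
\<close>

definition sup_congruence :: "('a, 'c) gorder_scheme \<Rightarrow> ('a \<times> 'a) set \<Rightarrow> bool"
  where "sup_congruence L \<theta> \<longleftrightarrow>
    equiv (carrier L) \<theta> \<and> (\<forall>P \<subseteq> \<theta>. (\<Squnion>\<^bsub>L\<^esub>(fst ` P), \<Squnion>\<^bsub>L\<^esub>(snd ` P)) \<in> \<theta>)"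

definition generated_sup_congruence :: "('a, 'c) gorder_scheme \<Rightarrow> ('a \<times> 'a) set \<Rightarrow> ('a \<times> 'a) set"
  where "generated_sup_congruence L R = \<Inter>{\<theta>. sup_congruence L \<theta> \<and> R \<subseteq> \<theta>}"

text \<open>
  The quotient carries the order induced by its join, \<open>[x] \<le> [y]\<close> iff \<open>[x \<squnion> y] = [y]\<close>;
  see \<open>sup_quotient_join\<close> below for its arbitrary joins.
\<close>

definition sup_quotient :: "('a, 'c) gorder_scheme \<Rightarrow> ('a \<times> 'a) set \<Rightarrow> 'a set gorder"
  where "sup_quotient L \<theta> =
    \<lparr>carrier = carrier L // \<theta>, eq = (=),
     le = (\<lambda>X Y. \<exists>x\<in>X. \<exists>y\<in>Y. x \<squnion>\<^bsub>L\<^esub> y \<in> Y)\<rparr>"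


section \<open>Quantales and their modules\<close>

record 'q quantale = "'q gorder" +
  qmult :: "['q, 'q] \<Rightarrow> 'q" (infixl \<open>\<odot>\<index>\<close> 70)
  qunit :: 'q

locale quantale = sup_lattice Q for Q (structure) +
  assumes monoid: "monoid \<lparr>carrier = carrier Q, mult = qmult Q, one = qunit Q\<rparr>"
    and sup_mult_distrib:
      "\<lbrakk>A \<subseteq> carrier Q; q \<in> carrier Q\<rbrakk> \<Longrightarrow> (\<Squnion>A) \<odot> q = \<Squnion>((\<lambda>a. a \<odot> q) ` A)"
    and mult_sup_distrib:
      "\<lbrakk>A \<subseteq> carrier Q; q \<in> carrier Q\<rbrakk> \<Longrightarrow> q \<odot> (\<Squnion>A) = \<Squnion>((\<lambda>a. q \<odot> a) ` A)"

record ('q, 'm) left_qmodule = "'m gorder" +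
  lact :: "['q, 'm] \<Rightarrow> 'm"

record ('q, 'm) right_qmodule = "'m gorder" +
  ract :: "['m, 'q] \<Rightarrow> 'm"

locale left_qmodule = Q: quantale Q + M: sup_lattice M for Q and M +
  assumes lact_closed: "\<lbrakk>q \<in> carrier Q; m \<in> carrier M\<rbrakk> \<Longrightarrow> lact M q m \<in> carrier M"
    and lact_sup_scalar:
      "\<lbrakk>A \<subseteq> carrier Q; m \<in> carrier M\<rbrakk> \<Longrightarrow>
        lact M (\<Squnion>\<^bsub>Q\<^esub>A) m = \<Squnion>\<^bsub>M\<^esub>((\<lambda>q. lact M q m) ` A)"
    and lact_sup:
      "\<lbrakk>q \<in> carrier Q; B \<subseteq> carrier M\<rbrakk> \<Longrightarrow>
        lact M q (\<Squnion>\<^bsub>M\<^esub>B) = \<Squnion>\<^bsub>M\<^esub>((\<lambda>m. lact M q m) ` B)"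
    and lact_mult:
      "\<lbrakk>p \<in> carrier Q; q \<in> carrier Q; m \<in> carrier M\<rbrakk> \<Longrightarrow>
        lact M (p \<odot>\<^bsub>Q\<^esub> q) m = lact M p (lact M q m)"
    and lact_unit: "m \<in> carrier M \<Longrightarrow> lact M (qunit Q) m = m"

locale right_qmodule = Q: quantale Q + M: sup_lattice M for Q and M +
  assumes ract_closed: "\<lbrakk>m \<in> carrier M; q \<in> carrier Q\<rbrakk> \<Longrightarrow> ract M m q \<in> carrier M"
    and ract_sup_scalar:
      "\<lbrakk>A \<subseteq> carrier Q; m \<in> carrier M\<rbrakk> \<Longrightarrow>
        ract M m (\<Squnion>\<^bsub>Q\<^esub>A) = \<Squnion>\<^bsub>M\<^esub>((\<lambda>q. ract M m q) ` A)"
    and ract_sup: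
      "\<lbrakk>q \<in> carrier Q; B \<subseteq> carrier M\<rbrakk> \<Longrightarrow>
        ract M (\<Squnion>\<^bsub>M\<^esub>B) q = \<Squnion>\<^bsub>M\<^esub>((\<lambda>m. ract M m q) ` B)"
    and ract_mult:
      "\<lbrakk>m \<in> carrier M; p \<in> carrier Q; q \<in> carrier Q\<rbrakk> \<Longrightarrow>
        ract M m (p \<odot>\<^bsub>Q\<^esub> q) = ract M (ract M m p) q"
    and ract_unit: "m \<in> carrier M \<Longrightarrow> ract M m (qunit Q) = m"


section \<open>Bimorphisms and tensor products\<close>

definition bimorphism ::
  "'q quantale \<Rightarrow> ('q, 'a) right_qmodule \<Rightarrow> ('q, 'b) left_qmodule \<Rightarrow> 'l gorder \<Rightarrow> ('a \<times> 'b \<Rightarrow> 'l) \<Rightarrow> bool"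
  where "bimorphism Q M1 M2 L f \<longleftrightarrow>
    f \<in> carrier M1 \<times> carrier M2 \<rightarrow> carrier L \<and>
    (\<forall>A y. A \<subseteq> carrier M1 \<longrightarrow> y \<in> carrier M2 \<longrightarrow> f (\<Squnion>\<^bsub>M1\<^esub>A, y) = \<Squnion>\<^bsub>L\<^esub>((\<lambda>a. f (a, y)) ` A)) \<and>
    (\<forall>x B. x \<in> carrier M1 \<longrightarrow> B \<subseteq> carrier M2 \<longrightarrow> f (x, \<Squnion>\<^bsub>M2\<^esub>B) = \<Squnion>\<^bsub>L\<^esub>((\<lambda>b. f (x, b)) ` B)) \<and>
    (\<forall>x\<in>carrier M1. \<forall>q\<in>carrier Q. \<forall>y\<in>carrier M2. f (ract M1 x q, y) = f (x, lact M2 q y))"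

text \<open>
  The universal property of a sup-lattice \<open>T\<close> with a bimorphism \<open>\<tau>\<close>, tested against all
  sup-lattices \<open>L\<close> whose elements live in the type \<open>'l\<close> (HOL has no quantifier over types, so
  the type is a parameter).  The function \<open>k\<close> is taken in the extensional function
  space \<open>\<rightarrow>\<^sub>E\<close>, so that uniqueness refers to its values on \<open>carrier T\<close> only.
\<close>

definition is_tensor_product ::
  "'l itself \<Rightarrow> 'q quantale \<Rightarrow> ('q, 'a) right_qmodule \<Rightarrow> ('q, 'b) left_qmodule \<Rightarrow>
    't gorder \<Rightarrow> ('a \<times> 'b \<Rightarrow> 't) \<Rightarrow> bool"
  where "is_tensor_product (_ :: 'l itself) Q M1 M2 T \<tau> \<longleftrightarrow>
    sup_lattice T \<and> bimorphism Q M1 M2 T \<tau> \<and>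
    (\<forall>(L :: 'l gorder) f. sup_lattice L \<longrightarrow> bimorphism Q M1 M2 L f \<longrightarrow>
      (\<exists>!k. k \<in> carrier T \<rightarrow>\<^sub>E carrier L \<and> k \<in> sup_hom T L \<and>
            (\<forall>p \<in> carrier M1 \<times> carrier M2. k (\<tau> p) = f p)))"

definition tensor_relation ::
  "'q quantale \<Rightarrow> ('q, 'a) right_qmodule \<Rightarrow> ('q, 'b) left_qmodule \<Rightarrow>
    (('a \<times> 'b) set \<times> ('a \<times> 'b) set) set"
  where "tensor_relation Q M1 M2 =
    {({(\<Squnion>\<^bsub>M1\<^esub>A, y)}, \<Union>a\<in>A. {(a, y)}) | A y. A \<subseteq> carrier M1 \<and> y \<in> carrier M2} \<union>
    {({(x, \<Squnion>\<^bsub>M2\<^esub>B)}, \<Union>b\<in>B. {(x, b)}) | x B. x \<in> carrier M1 \<and> B \<subseteq> carrier M2} \<union>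
    {({(ract M1 x q, y)}, {(x, lact M2 q y)}) | x q y.
      x \<in> carrier M1 \<and> q \<in> carrier Q \<and> y \<in> carrier M2}"

definition tensor_congruence ::
  "'q quantale \<Rightarrow> ('q, 'a) right_qmodule \<Rightarrow> ('q, 'b) left_qmodule \<Rightarrow>
    (('a \<times> 'b) set \<times> ('a \<times> 'b) set) set"
  where "tensor_congruence Q M1 M2 =
    generated_sup_congruence (powerset_lattice (carrier M1 \<times> carrier M2)) (tensor_relation Q M1 M2)"

definition tensor_quotient ::
  "'q quantale \<Rightarrow> ('q, 'a) right_qmodule \<Rightarrow> ('q, 'b) left_qmodule \<Rightarrow> ('a \<times> 'b) set set gorder"
  where "tensor_quotient Q M1 M2 =
    sup_quotient (powerset_lattice (carrier M1 \<times> carrier M2)) (tensor_congruence Q M1 M2)"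

definition tensor_map ::
  "'q quantale \<Rightarrow> ('q, 'a) right_qmodule \<Rightarrow> ('q, 'b) left_qmodule \<Rightarrow> 'a \<times> 'b \<Rightarrow> ('a \<times> 'b) set set"
  where "tensor_map Q M1 M2 p = tensor_congruence Q M1 M2 `` {{p}}"


section \<open>Joins in powersets and in quotients\<close>

lemma (in partial_order) sup_eqI:
  assumes "least L s (Upper L A)"
  shows "\<Squnion>\<^bsub>L\<^esub>A = s"
  unfolding sup_def by (rule some_equality) (use assms least_unique in blast)+

lemma (in sup_lattice) sup_least_Upper: "A \<subseteq> carrier L \<Longrightarrow> least L (\<Squnion>\<^bsub>L\<^esub>A) (Upper L A)"
  unfolding sup_def by (rule someI_ex) (rule sup_exists)

lemma powerset_is_lub:
  "\<A> \<subseteq> Pow X \<Longrightarrow> least (powerset_lattice X) (\<Union>\<A>) (Upper (powerset_lattice X) \<A>)"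
  unfolding powerset_lattice_def least_def Upper_def by simp blast

lemma sup_lattice_powerset: "sup_lattice (powerset_lattice X)"
proof -
  have "partial_order (powerset_lattice X)"
    by unfold_locales (auto simp: powerset_lattice_def)
  moreover have "\<exists>s. least (powerset_lattice X) s (Upper (powerset_lattice X) A)"
    if "A \<subseteq> carrier (powerset_lattice X)" for A
    using powerset_is_lub[of A X] that by (auto simp: powerset_lattice_def)
  ultimately show ?thesis
    by (simp add: sup_lattice_def sup_lattice_axioms_def)
qed

lemma powerset_join: "\<A> \<subseteq> Pow X \<Longrightarrow> \<Squnion>\<^bsub>powerset_lattice X\<^esub>\<A> = \<Union>\<A>"
  using partial_order.sup_eqI[OF sup_lattice.axioms(1)[OF sup_lattice_powerset] powerset_is_lub] .

lemma sup_congruence_join: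
  assumes "sup_congruence L \<theta>" and "(x, x') \<in> \<theta>" and "(y, y') \<in> \<theta>"
  shows "(x \<squnion>\<^bsub>L\<^esub> y, x' \<squnion>\<^bsub>L\<^esub> y') \<in> \<theta>"
proof -
  have "{(x, x'), (y, y')} \<subseteq> \<theta>" using assms by auto
  then have "(\<Squnion>\<^bsub>L\<^esub>(fst ` {(x, x'), (y, y')}), \<Squnion>\<^bsub>L\<^esub>(snd ` {(x, x'), (y, y')})) \<in> \<theta>"
    using assms(1) unfolding sup_congruence_def by blast
  then show ?thesis by (simp add: join_def)
qed

lemma sup_quotient_le_iff:
  assumes "sup_congruence L \<theta>" and "x \<in> carrier L" and "y \<in> carrier L"
  shows "\<theta> `` {x} \<sqsubseteq>\<^bsub>sup_quotient L \<theta>\<^esub> \<theta> `` {y} \<longleftrightarrow> (x \<squnion>\<^bsub>L\<^esub> y, y) \<in> \<theta>"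
proof -
  have eq: "equiv (carrier L) \<theta>" using assms(1) by (simp add: sup_congruence_def)
  have refl: "(x, x) \<in> \<theta>" "(y, y) \<in> \<theta>"
    using eq assms(2,3) by (auto simp: equiv_def refl_on_def)
  have sym: "sym \<theta>" and trans: "trans \<theta>" using eq by (auto simp: equiv_def)
  show ?thesis
  proof
    assume "\<theta> `` {x} \<sqsubseteq>\<^bsub>sup_quotient L \<theta>\<^esub> \<theta> `` {y}"
    then obtain x' y' where *: "(x, x') \<in> \<theta>" "(y, y') \<in> \<theta>" "(y, x' \<squnion>\<^bsub>L\<^esub> y') \<in> \<theta>"
      by (auto simp: sup_quotient_def)
    have "(x \<squnion>\<^bsub>L\<^esub> y, x' \<squnion>\<^bsub>L\<^esub> y') \<in> \<theta>" using sup_congruence_join[OF assms(1) *(1,2)] .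
    then show "(x \<squnion>\<^bsub>L\<^esub> y, y) \<in> \<theta>" using *(3) sym trans by (meson symD transD)
  next
    assume "(x \<squnion>\<^bsub>L\<^esub> y, y) \<in> \<theta>"
    then show "\<theta> `` {x} \<sqsubseteq>\<^bsub>sup_quotient L \<theta>\<^esub> \<theta> `` {y}"
      using refl sym by (auto simp: sup_quotient_def dest: symD)
  qed
qed

lemma (in sup_lattice) join_carrier:
  "x \<in> carrier L \<Longrightarrow> y \<in> carrier L \<Longrightarrow> x \<squnion>\<^bsub>L\<^esub> y \<in> carrier L"
  unfolding join_def using sup_least_Upper[of "{x, y}"] by (simp add: least_closed)

lemma (in sup_lattice) sup_join_absorb:
  assumes A: "A \<subseteq> carrier L" and a: "a \<in> A"
  shows "a \<squnion>\<^bsub>L\<^esub> (\<Squnion>\<^bsub>L\<^esub>A) = \<Squnion>\<^bsub>L\<^esub>A"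
  unfolding join_def
proof (rule sup_eqI)
  have l: "least L (\<Squnion>\<^bsub>L\<^esub>A) (Upper L A)" by (rule sup_least_Upper[OF A])
  have "a \<sqsubseteq>\<^bsub>L\<^esub> \<Squnion>\<^bsub>L\<^esub>A" using l a A by (meson Upper_memD least_mem)
  then show "least L (\<Squnion>\<^bsub>L\<^esub>A) (Upper L {a, \<Squnion>\<^bsub>L\<^esub>A})"
    using least_closed[OF l] a A by (auto simp: least_def Upper_def)
qed

lemma (in sup_lattice) sup_join_const:
  assumes A: "A \<subseteq> carrier L" and b: "b \<in> carrier L"
  shows "\<Squnion>\<^bsub>L\<^esub>((\<lambda>a. a \<squnion>\<^bsub>L\<^esub> b) ` A \<union> {b}) = (\<Squnion>\<^bsub>L\<^esub>A) \<squnion>\<^bsub>L\<^esub> b"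
proof (rule sup_eqI)
  have l: "least L (\<Squnion>\<^bsub>L\<^esub>A) (Upper L A)" by (rule sup_least_Upper[OF A])
  have s: "\<Squnion>\<^bsub>L\<^esub>A \<in> carrier L" using least_closed[OF l] .
  have j: "x \<squnion>\<^bsub>L\<^esub> b \<sqsubseteq>\<^bsub>L\<^esub> u \<longleftrightarrow> x \<sqsubseteq>\<^bsub>L\<^esub> u \<and> b \<sqsubseteq>\<^bsub>L\<^esub> u"
    if x: "x \<in> carrier L" and u: "u \<in> carrier L" for x u
  proof -
    have lj: "least L (x \<squnion>\<^bsub>L\<^esub> b) (Upper L {x, b})"
      unfolding join_def using sup_least_Upper x b by simp
    have c: "x \<squnion>\<^bsub>L\<^esub> b \<in> carrier L" using least_closed[OF lj] .
    have "x \<sqsubseteq>\<^bsub>L\<^esub> x \<squnion>\<^bsub>L\<^esub> b" "b \<sqsubseteq>\<^bsub>L\<^esub> x \<squnion>\<^bsub>L\<^esub> b"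
      using lj x b by (auto simp: least_def Upper_def)
    moreover have "x \<squnion>\<^bsub>L\<^esub> b \<sqsubseteq>\<^bsub>L\<^esub> u" if "x \<sqsubseteq>\<^bsub>L\<^esub> u" "b \<sqsubseteq>\<^bsub>L\<^esub> u"
      using lj u that by (auto simp: least_def Upper_def)
    ultimately show ?thesis using x b u c by (meson le_trans)
  qed
  have k: "\<Squnion>\<^bsub>L\<^esub>A \<sqsubseteq>\<^bsub>L\<^esub> u \<longleftrightarrow> (\<forall>a\<in>A. a \<sqsubseteq>\<^bsub>L\<^esub> u)" if u: "u \<in> carrier L" for u
  proof
    assume h: "\<Squnion>\<^bsub>L\<^esub>A \<sqsubseteq>\<^bsub>L\<^esub> u"
    show "\<forall>a\<in>A. a \<sqsubseteq>\<^bsub>L\<^esub> u"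
    proof
      fix a assume a: "a \<in> A"
      have "a \<sqsubseteq>\<^bsub>L\<^esub> \<Squnion>\<^bsub>L\<^esub>A" using l a A by (meson Upper_memD least_mem)
      then show "a \<sqsubseteq>\<^bsub>L\<^esub> u" using h a A s u by (meson le_trans subsetD)
    qed
  next
    assume "\<forall>a\<in>A. a \<sqsubseteq>\<^bsub>L\<^esub> u"
    then show "\<Squnion>\<^bsub>L\<^esub>A \<sqsubseteq>\<^bsub>L\<^esub> u" using l u by (auto simp: least_def Upper_def)
  qed
  have sj: "(\<Squnion>\<^bsub>L\<^esub>A) \<squnion>\<^bsub>L\<^esub> b \<in> carrier L" using join_carrier[OF s b] .
  have up: "Upper L ((\<lambda>a. a \<squnion>\<^bsub>L\<^esub> b) ` A \<union> {b}) = {u \<in> carrier L. (\<Squnion>\<^bsub>L\<^esub>A) \<squnion>\<^bsub>L\<^esub> b \<sqsubseteq>\<^bsub>L\<^esub> u}"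
  proof -
    have sub: "(\<lambda>a. a \<squnion>\<^bsub>L\<^esub> b) ` A \<union> {b} \<subseteq> carrier L" using A b join_carrier by auto
    have "(\<forall>x. x \<in> ((\<lambda>a. a \<squnion>\<^bsub>L\<^esub> b) ` A \<union> {b}) \<inter> carrier L \<longrightarrow> x \<sqsubseteq>\<^bsub>L\<^esub> u)
        \<longleftrightarrow> (\<Squnion>\<^bsub>L\<^esub>A) \<squnion>\<^bsub>L\<^esub> b \<sqsubseteq>\<^bsub>L\<^esub> u" if u: "u \<in> carrier L" for u
    proof -
      have "(\<forall>x. x \<in> ((\<lambda>a. a \<squnion>\<^bsub>L\<^esub> b) ` A \<union> {b}) \<inter> carrier L \<longrightarrow> x \<sqsubseteq>\<^bsub>L\<^esub> u)
          \<longleftrightarrow> (\<forall>a\<in>A. a \<squnion>\<^bsub>L\<^esub> b \<sqsubseteq>\<^bsub>L\<^esub> u) \<and> b \<sqsubseteq>\<^bsub>L\<^esub> u"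
        unfolding Int_absorb2[OF sub] by auto
      also have "\<dots> \<longleftrightarrow> (\<forall>a\<in>A. a \<sqsubseteq>\<^bsub>L\<^esub> u) \<and> b \<sqsubseteq>\<^bsub>L\<^esub> u"
        using j[OF subsetD[OF A] u] by blast
      also have "\<dots> \<longleftrightarrow> (\<Squnion>\<^bsub>L\<^esub>A) \<squnion>\<^bsub>L\<^esub> b \<sqsubseteq>\<^bsub>L\<^esub> u"
        using j[OF s u] k[OF u] by blast
      finally show ?thesis .
    qed
    then show ?thesis unfolding Upper_def by blast
  qed
  show "least L ((\<Squnion>\<^bsub>L\<^esub>A) \<squnion>\<^bsub>L\<^esub> b) (Upper L ((\<lambda>a. a \<squnion>\<^bsub>L\<^esub> b) ` A \<union> {b}))"
    unfolding up least_def using sj by auto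
qed

lemma sup_quotient_join:
  assumes L: "sup_lattice L" and \<theta>: "sup_congruence L \<theta>"
  shows "sup_lattice (sup_quotient L \<theta>)"
    and "A \<subseteq> carrier L \<Longrightarrow> \<Squnion>\<^bsub>sup_quotient L \<theta>\<^esub>((\<lambda>x. \<theta> `` {x}) ` A) = \<theta> `` {\<Squnion>\<^bsub>L\<^esub>A}"
proof -
  interpret sup_lattice L by (rule L)
  let ?K = "sup_quotient L \<theta>"
  let ?c = "\<lambda>x. \<theta> `` {x}"
  have eq: "equiv (carrier L) \<theta>" using \<theta> by (simp add: sup_congruence_def)
  have refl: "(x, x) \<in> \<theta>" if "x \<in> carrier L" for x
    using eq that by (auto simp: equiv_def refl_on_def)
  have sym: "(y, x) \<in> \<theta>" if "(x, y) \<in> \<theta>" for x y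
    using eq that by (auto simp: equiv_def dest: symD)
  have trans: "(x, z) \<in> \<theta>" if "(x, y) \<in> \<theta>" "(y, z) \<in> \<theta>" for x y z
    using eq that by (auto simp: equiv_def dest: transD)
  have car: "carrier ?K = ?c ` carrier L"
    by (auto simp: sup_quotient_def quotient_def)
  have ceq: "?c x = ?c y \<longleftrightarrow> (x, y) \<in> \<theta>" if "x \<in> carrier L" "y \<in> carrier L" for x y
    using eq_equiv_class_iff[OF eq] that by simp
  have le: "?c x \<sqsubseteq>\<^bsub>?K\<^esub> ?c y \<longleftrightarrow> (x \<squnion>\<^bsub>L\<^esub> y, y) \<in> \<theta>" if "x \<in> carrier L" "y \<in> carrier L" for x y
    using sup_quotient_le_iff[OF \<theta>] that .
  have sup1: "\<Squnion>\<^bsub>L\<^esub>{x} = x" if "x \<in> carrier L" for x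
    by (rule sup_eqI) (use that in \<open>auto simp: least_def Upper_def\<close>)
  have supc: "\<Squnion>\<^bsub>L\<^esub>A \<in> carrier L" if "A \<subseteq> carrier L" for A
    using sup_least_Upper[OF that] by simp
  have sup_le: "?c (\<Squnion>\<^bsub>L\<^esub>A) \<sqsubseteq>\<^bsub>?K\<^esub> ?c u"
    if A: "A \<subseteq> carrier L" and u: "u \<in> carrier L" and h: "\<And>a. a \<in> A \<Longrightarrow> ?c a \<sqsubseteq>\<^bsub>?K\<^esub> ?c u" for A u
  proof -
    let ?P = "insert (u, u) ((\<lambda>a. (a \<squnion>\<^bsub>L\<^esub> u, u)) ` A)"
    have "(a \<squnion>\<^bsub>L\<^esub> u, u) \<in> \<theta>" if "a \<in> A" for a
      using h[OF that] le[OF subsetD[OF A that] u] by simp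
    then have "?P \<subseteq> \<theta>" using refl[OF u] by blast
    then have "(\<Squnion>\<^bsub>L\<^esub>(fst ` ?P), \<Squnion>\<^bsub>L\<^esub>(snd ` ?P)) \<in> \<theta>"
      using \<theta> unfolding sup_congruence_def by blast
    moreover have "fst ` ?P = (\<lambda>a. a \<squnion>\<^bsub>L\<^esub> u) ` A \<union> {u}" "snd ` ?P = {u}" by (auto simp: image_image)
    ultimately have "((\<Squnion>\<^bsub>L\<^esub>A) \<squnion>\<^bsub>L\<^esub> u, u) \<in> \<theta>"
      by (simp only: sup_join_const[OF A u] sup1[OF u])
    then show ?thesis using le[OF supc[OF A] u] by simp
  qed
  have le_sup: "?c a \<sqsubseteq>\<^bsub>?K\<^esub> ?c (\<Squnion>\<^bsub>L\<^esub>A)" if A: "A \<subseteq> carrier L" and a: "a \<in> A" for A a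
    using le[OF _ supc[OF A], of a] sup_join_absorb[OF A a] refl[OF supc[OF A]] a A by auto
  have comm: "x \<squnion>\<^bsub>L\<^esub> y = y \<squnion>\<^bsub>L\<^esub> x" for x y
    by (simp add: join_def insert_commute)
  have eqK: "(.=\<^bsub>?K\<^esub>) = (=)" by (simp add: sup_quotient_def)
  have po: "partial_order ?K"
  proof unfold_locales
    show "(.=\<^bsub>?K\<^esub>) = (=)" by (rule eqK)
    show "X \<sqsubseteq>\<^bsub>?K\<^esub> X" if c: "X \<in> carrier ?K" for X
    proof -
      obtain x where x: "x \<in> carrier L" "X = ?c x" using c unfolding car by blast
      have "x \<squnion>\<^bsub>L\<^esub> x = x" using sup1[OF x(1)] by (simp add: join_def)
      then show ?thesis using le[OF x(1) x(1)] refl[OF x(1)] x(2) by simp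
    qed
    show "X .=\<^bsub>?K\<^esub> Y" if h: "X \<sqsubseteq>\<^bsub>?K\<^esub> Y" "Y \<sqsubseteq>\<^bsub>?K\<^esub> X" and c: "X \<in> carrier ?K" "Y \<in> carrier ?K" for X Y
    proof -
      obtain x y where xy: "x \<in> carrier L" "y \<in> carrier L" and e: "X = ?c x" "Y = ?c y"
        using c unfolding car by blast
      have "(x \<squnion>\<^bsub>L\<^esub> y, y) \<in> \<theta>" "(x \<squnion>\<^bsub>L\<^esub> y, x) \<in> \<theta>"
        using h le[OF xy] le[OF xy(2,1)] comm[of y x] unfolding e by simp_all
      then have "X = Y" using trans[OF sym] ceq[OF xy] e by blast
      then show ?thesis by (simp add: sup_quotient_def)
    qed
    show "X \<sqsubseteq>\<^bsub>?K\<^esub> Z" if h: "X \<sqsubseteq>\<^bsub>?K\<^esub> Y" "Y \<sqsubseteq>\<^bsub>?K\<^esub> Z"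
      and c: "X \<in> carrier ?K" "Y \<in> carrier ?K" "Z \<in> carrier ?K" for X Y Z
    proof -
      obtain x y z where xyz: "x \<in> carrier L" "y \<in> carrier L" "z \<in> carrier L"
        and e: "X = ?c x" "Y = ?c y" "Z = ?c z"
        using c unfolding car by blast
      have "(x \<squnion>\<^bsub>L\<^esub> y, y) \<in> \<theta>" using h(1) le xyz e by simp
      then have "?c y = ?c (\<Squnion>\<^bsub>L\<^esub>{x, y})"
        using ceq[OF supc[of "{x, y}"] xyz(2)] xyz unfolding join_def by simp
      then have "?c (\<Squnion>\<^bsub>L\<^esub>{x, y}) \<sqsubseteq>\<^bsub>?K\<^esub> ?c z" using h(2) e by simp
      then have tz: "((\<Squnion>\<^bsub>L\<^esub>{x, y}) \<squnion>\<^bsub>L\<^esub> z, z) \<in> \<theta>" using le supc[of "{x, y}"] xyz by simp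
      have absorb: "x \<squnion>\<^bsub>L\<^esub> ((\<Squnion>\<^bsub>L\<^esub>{x, y}) \<squnion>\<^bsub>L\<^esub> z) = (\<Squnion>\<^bsub>L\<^esub>{x, y}) \<squnion>\<^bsub>L\<^esub> z"
      proof -
        let ?S = "(\<lambda>a. a \<squnion>\<^bsub>L\<^esub> z) ` {x, y} \<union> {z}"
        let ?t = "(\<Squnion>\<^bsub>L\<^esub>{x, y}) \<squnion>\<^bsub>L\<^esub> z"
        have s: "\<Squnion>\<^bsub>L\<^esub>{x, y} \<in> carrier L" using supc xyz by simp
        have t: "?t \<in> carrier L" using join_carrier[OF s xyz(3)] .
        have "x \<sqsubseteq>\<^bsub>L\<^esub> \<Squnion>\<^bsub>L\<^esub>{x, y}"
          using sup_least_Upper[of "{x, y}"] xyz by (auto simp: least_def Upper_def)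
        moreover have "\<Squnion>\<^bsub>L\<^esub>{x, y} \<sqsubseteq>\<^bsub>L\<^esub> ?t"
          using sup_least_Upper[of "{\<Squnion>\<^bsub>L\<^esub>{x, y}, z}"] s xyz
          by (auto simp: least_def Upper_def join_def)
        ultimately have "x \<sqsubseteq>\<^bsub>L\<^esub> ?t" using xyz s t by (meson le_trans)
        then have "least L ?t (Upper L {x, ?t})"
          using xyz t by (auto simp: least_def Upper_def)
        then show ?thesis unfolding join_def[of L x] by (rule sup_eqI)
      qed
      have "(\<Squnion>\<^bsub>L\<^esub>{x, y} \<squnion>\<^bsub>L\<^esub> z, x \<squnion>\<^bsub>L\<^esub> z) \<in> \<theta>"
        using sup_congruence_join[OF \<theta> refl[OF xyz(1)] tz] unfolding absorb .
      then have "(x \<squnion>\<^bsub>L\<^esub> z, z) \<in> \<theta>" by (rule trans[OF sym tz])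
      then show ?thesis using le xyz e by simp
    qed
  qed (simp_all add: eqK)
  have lub: "least ?K (?c (\<Squnion>\<^bsub>L\<^esub>A)) (Upper ?K (?c ` A))" if A: "A \<subseteq> carrier L" for A
    unfolding least_def
  proof (intro conjI ballI)
    show "?c (\<Squnion>\<^bsub>L\<^esub>A) \<in> Upper ?K (?c ` A)"
      using le_sup[OF A] supc[OF A] unfolding Upper_def car by auto
    fix U
    assume "U \<in> Upper ?K (?c ` A)"
    then obtain u where "u \<in> carrier L" "U = ?c u" "\<And>a. a \<in> A \<Longrightarrow> ?c a \<sqsubseteq>\<^bsub>?K\<^esub> ?c u"
      using A unfolding Upper_def car by blast
    then show "?c (\<Squnion>\<^bsub>L\<^esub>A) \<sqsubseteq>\<^bsub>?K\<^esub> U" using sup_le[OF A] by simp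
  qed (rule Upper_closed)
  show "sup_lattice ?K"
  proof (intro sup_lattice.intro po sup_lattice_axioms.intro)
    fix B assume "B \<subseteq> carrier ?K"
    then obtain A where "A \<subseteq> carrier L" "B = ?c ` A"
      unfolding car by (meson subset_imageE)
    then show "\<exists>s. least ?K s (Upper ?K B)" using lub by blast
  qed
  show "\<Squnion>\<^bsub>?K\<^esub>(?c ` A) = ?c (\<Squnion>\<^bsub>L\<^esub>A)" if "A \<subseteq> carrier L"
    using partial_order.sup_eqI[OF po lub[OF that]] .
qed

end

theory Submission
  imports Defs
begin

text \<open>
  A bimorphism \<open>f\<close> extends to the sup-lattice homomorphism \<open>S \<mapsto> \<Squnion>(f ` S)\<close> on
  the powerset of \<open>M\<^sub>1 \<times> M\<^sub>2\<close>.  Its kernel is a sup-congruence, and the bimorphism laws say that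
  this kernel contains \<open>R'\<close>; hence it contains the congruence generated by \<open>R'\<close>, and the
  homomorphism factors through the quotient.  The factor is unique because every class \<open>[S]\<close>
  is the join of the classes \<open>[{p}]\<close> with \<open>p \<in> S\<close>.
\<close>

section \<open>Joins determined by their upper bounds\<close>

lemma (in sup_lattice) sup_carrier [simp, intro]:
  "A \<subseteq> carrier L \<Longrightarrow> \<Squnion>\<^bsub>L\<^esub>A \<in> carrier L"
  using least_closed[OF sup_least_Upper] .

lemma (in sup_lattice) sup_le_iff:
  assumes A: "A \<subseteq> carrier L" and u: "u \<in> carrier L"
  shows "\<Squnion>\<^bsub>L\<^esub>A \<sqsubseteq>\<^bsub>L\<^esub> u \<longleftrightarrow> (\<forall>a\<in>A. a \<sqsubseteq>\<^bsub>L\<^esub> u)"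
proof -
  have l: "least L (\<Squnion>\<^bsub>L\<^esub>A) (Upper L A)" by (rule sup_least_Upper[OF A])
  have "a \<sqsubseteq>\<^bsub>L\<^esub> \<Squnion>\<^bsub>L\<^esub>A" if "a \<in> A" for a
    using l that A by (meson Upper_memD least_mem)
  moreover have "\<Squnion>\<^bsub>L\<^esub>A \<sqsubseteq>\<^bsub>L\<^esub> u" if "\<forall>a\<in>A. a \<sqsubseteq>\<^bsub>L\<^esub> u"
    using l u that by (auto simp: least_def Upper_def)
  ultimately show ?thesis using A u sup_carrier[OF A] by (meson le_trans subsetD)
qed

text \<open>Taking \<open>u\<close> to be \<open>s\<close> and then the join itself gives the two
  inequalities, and antisymmetry concludes. An identity between joins thus becomes a comparison of
  upper bounds.\<close>

lemma (in sup_lattice) sup_eq_if_le_iff: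
  assumes s: "s \<in> carrier L" and A: "A \<subseteq> carrier L"
    and le: "\<And>u. u \<in> carrier L \<Longrightarrow> s \<sqsubseteq>\<^bsub>L\<^esub> u \<longleftrightarrow> (\<forall>a\<in>A. a \<sqsubseteq>\<^bsub>L\<^esub> u)"
  shows "\<Squnion>\<^bsub>L\<^esub>A = s"
  using assms sup_le_iff[OF A] by (meson le_antisym le_refl sup_carrier)

lemma (in sup_lattice) sup_singleton: "x \<in> carrier L \<Longrightarrow> \<Squnion>\<^bsub>L\<^esub>{x} = x"
  by (rule sup_eq_if_le_iff) auto

text \<open>An element bounds the union iff it bounds every member of the family, that is, iff it
  bounds every member's join. This associativity makes the extension of a map to the powerset
  preserve joins.\<close>

lemma (in sup_lattice) sup_Union:
  assumes "\<A> \<subseteq> Pow (carrier L)"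
  shows "\<Squnion>\<^bsub>L\<^esub>(\<Union>\<A>) = \<Squnion>\<^bsub>L\<^esub>((\<lambda>A. \<Squnion>\<^bsub>L\<^esub>A) ` \<A>)"
proof (rule sup_eq_if_le_iff)
  have sub: "(\<lambda>A. \<Squnion>\<^bsub>L\<^esub>A) ` \<A> \<subseteq> carrier L" using assms by auto
  then show "\<Squnion>\<^bsub>L\<^esub>((\<lambda>A. \<Squnion>\<^bsub>L\<^esub>A) ` \<A>) \<in> carrier L" by blast
  show "\<Union>\<A> \<subseteq> carrier L" using assms by blast
  fix u assume u: "u \<in> carrier L"
  have "\<Squnion>\<^bsub>L\<^esub>A \<sqsubseteq>\<^bsub>L\<^esub> u \<longleftrightarrow> (\<forall>a\<in>A. a \<sqsubseteq>\<^bsub>L\<^esub> u)" if "A \<in> \<A>" for A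
    using sup_le_iff[of A, OF _ u] assms that by auto
  then show "\<Squnion>\<^bsub>L\<^esub>((\<lambda>A. \<Squnion>\<^bsub>L\<^esub>A) ` \<A>) \<sqsubseteq>\<^bsub>L\<^esub> u \<longleftrightarrow> (\<forall>a\<in>\<Union>\<A>. a \<sqsubseteq>\<^bsub>L\<^esub> u)"
    unfolding sup_le_iff[OF sub u] by auto
qed

section \<open>Homomorphisms of sup-lattices\<close>

lemma sup_homI:
  assumes "\<And>x. x \<in> carrier L \<Longrightarrow> f x \<in> carrier K"
    and "\<And>A. A \<subseteq> carrier L \<Longrightarrow> f (\<Squnion>\<^bsub>L\<^esub>A) = \<Squnion>\<^bsub>K\<^esub>(f ` A)"
  shows "f \<in> sup_hom L K"
  using assms by (auto simp: sup_hom_def)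

lemma sup_hom_closed: "f \<in> sup_hom L K \<Longrightarrow> x \<in> carrier L \<Longrightarrow> f x \<in> carrier K"
  by (auto simp: sup_hom_def)

lemma sup_hom_sup: "f \<in> sup_hom L K \<Longrightarrow> A \<subseteq> carrier L \<Longrightarrow> f (\<Squnion>\<^bsub>L\<^esub>A) = \<Squnion>\<^bsub>K\<^esub>(f ` A)"
  by (auto simp: sup_hom_def)

text \<open>Only values on the carrier matter, and joins stay in the carrier because
  \<open>L\<close> is a sup-lattice. The lemma serves to pass from a homomorphism to its
  \<open>restrict\<close>.\<close>

lemma sup_hom_cong:
  assumes f: "f \<in> sup_hom L K" and L: "sup_lattice L"
    and eq: "\<And>x. x \<in> carrier L \<Longrightarrow> g x = f x"
  shows "g \<in> sup_hom L K"
proof (rule sup_homI)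
  show "g x \<in> carrier K" if "x \<in> carrier L" for x
    using that eq sup_hom_closed[OF f] by simp
  fix A assume A: "A \<subseteq> carrier L"
  then have "g ` A = f ` A" using eq by (intro image_cong) auto
  then show "g (\<Squnion>\<^bsub>L\<^esub>A) = \<Squnion>\<^bsub>K\<^esub>(g ` A)"
    using sup_hom_sup[OF f A] eq sup_lattice.sup_carrier[OF L A] by simp
qed

lemma sup_hom_id: "(\<lambda>x. x) \<in> sup_hom L L"
  by (rule sup_homI) auto

lemma sup_hom_compose:
  assumes f: "f \<in> sup_hom L K" and g: "g \<in> sup_hom K N"
  shows "(\<lambda>x. g (f x)) \<in> sup_hom L N"
proof (rule sup_homI)
  show "g (f x) \<in> carrier N" if "x \<in> carrier L" for x
    using that f g by (simp add: sup_hom_closed)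
  fix A assume A: "A \<subseteq> carrier L"
  then have "f ` A \<subseteq> carrier K" using sup_hom_closed[OF f] by auto
  then show "g (f (\<Squnion>\<^bsub>L\<^esub>A)) = \<Squnion>\<^bsub>N\<^esub>((\<lambda>x. g (f x)) ` A)"
    by (simp add: sup_hom_sup[OF f A] sup_hom_sup[OF g] image_image)
qed

section \<open>Generated congruences, kernels and factorization through a quotient\<close>

lemma sup_congruence_total:
  assumes "sup_lattice L"
  shows "sup_congruence L (carrier L \<times> carrier L)"
proof -
  interpret sup_lattice L by fact
  have "(\<Squnion>\<^bsub>L\<^esub>(fst ` P), \<Squnion>\<^bsub>L\<^esub>(snd ` P)) \<in> carrier L \<times> carrier L"
    if "P \<subseteq> carrier L \<times> carrier L" for P
    using that by (auto intro!: sup_carrier)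
  then show ?thesis
    unfolding sup_congruence_def
    by (auto simp: equiv_def refl_on_def sym_def trans_def)
qed

text \<open>Every condition on a congruence is inherited by intersections. The assumption on
  \<open>R\<close> puts the total relation into the intersected family, which keeps the intersection
  inside \<open>carrier L \<times> carrier L\<close>.\<close>

lemma sup_congruence_generated:
  assumes "sup_lattice L" and "R \<subseteq> carrier L \<times> carrier L"
  shows "sup_congruence L (generated_sup_congruence L R)"
proof -
  let ?C = "{\<theta>. sup_congruence L \<theta> \<and> R \<subseteq> \<theta>}"
  have ne: "carrier L \<times> carrier L \<in> ?C"
    using sup_congruence_total[OF assms(1)] assms(2) by simp
  have equiv: "equiv (carrier L) \<theta>" if "\<theta> \<in> ?C" for \<theta>
    using that by (simp add: sup_congruence_def)
  have "equiv (carrier L) (\<Inter>?C)"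
  proof (rule equivI)
    show "\<Inter>?C \<subseteq> carrier L \<times> carrier L" using ne by (rule Inter_lower)
    show "refl_on (carrier L) (\<Inter>?C)"
      using equiv by (auto simp: equiv_def refl_on_def)
    show "sym (\<Inter>?C)"
      using equiv unfolding equiv_def by (intro symI InterI) (blast dest: symD)
    show "trans (\<Inter>?C)"
      using equiv unfolding equiv_def by (intro transI InterI) (blast dest: transD)
  qed
  moreover have "(\<Squnion>\<^bsub>L\<^esub>(fst ` P), \<Squnion>\<^bsub>L\<^esub>(snd ` P)) \<in> \<Inter>?C" if "P \<subseteq> \<Inter>?C" for P
  proof (rule InterI)
    fix \<theta> assume \<theta>: "\<theta> \<in> ?C"
    then have "P \<subseteq> \<theta>" using that by blast
    then show "(\<Squnion>\<^bsub>L\<^esub>(fst ` P), \<Squnion>\<^bsub>L\<^esub>(snd ` P)) \<in> \<theta>"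
      using \<theta> by (simp add: sup_congruence_def)
  qed
  ultimately show ?thesis
    unfolding sup_congruence_def generated_sup_congruence_def by blast
qed

lemma generated_sup_congruence_incl: "R \<subseteq> generated_sup_congruence L R"
  by (auto simp: generated_sup_congruence_def)

lemma generated_sup_congruence_least:
  "sup_congruence L \<theta> \<Longrightarrow> R \<subseteq> \<theta> \<Longrightarrow> generated_sup_congruence L R \<subseteq> \<theta>"
  by (auto simp: generated_sup_congruence_def)

text \<open>Combined with the leastness of a generated congruence, this reduces the claim that
  \<open>h\<close> respects the congruence to a check on the generating pairs.\<close>

lemma sup_congruence_kernel:
  assumes L: "sup_lattice L" and h: "h \<in> sup_hom L K"
  shows "sup_congruence L {(x, y) \<in> carrier L \<times> carrier L. h x = h y}"
proof -
  let ?\<theta> = "{(x, y) \<in> carrier L \<times> carrier L. h x = h y}"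
  have "(\<Squnion>\<^bsub>L\<^esub>(fst ` P), \<Squnion>\<^bsub>L\<^esub>(snd ` P)) \<in> ?\<theta>" if P: "P \<subseteq> ?\<theta>" for P
  proof -
    have sub: "fst ` P \<subseteq> carrier L" "snd ` P \<subseteq> carrier L" using P by auto
    \<comment> \<open>Both sides are images of \<open>P\<close>, under maps that agree on each of
      its pairs by the definition of the kernel.\<close>
    have "h ` fst ` P = h ` snd ` P"
      unfolding image_image using P by (intro image_cong) auto
    then show ?thesis
      using sub by (simp add: sup_hom_sup[OF h] sup_lattice.sup_carrier[OF L])
  qed
  moreover have "equiv (carrier L) ?\<theta>"
    by (auto simp: equiv_def refl_on_def sym_def trans_def)
  ultimately show ?thesis by (simp add: sup_congruence_def)
qed

lemma sup_quotient_carrier: "carrier (sup_quotient L \<theta>) = (\<lambda>x. \<theta> `` {x}) ` carrier L"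
  by (auto simp: sup_quotient_def quotient_def)

text \<open>Since \<open>h\<close> is constant on classes, \<open>k\<close> may evaluate it at any
  representative; joins of classes are classes of joins, so \<open>k\<close> inherits preservation
  of joins from \<open>h\<close>.\<close>

lemma sup_quotient_factor:
  assumes L: "sup_lattice L" and \<theta>: "sup_congruence L \<theta>"
    and h: "h \<in> sup_hom L K" and le: "\<And>x y. (x, y) \<in> \<theta> \<Longrightarrow> h x = h y"
  obtains k where "k \<in> carrier (sup_quotient L \<theta>) \<rightarrow>\<^sub>E carrier K"
    and "k \<in> sup_hom (sup_quotient L \<theta>) K"
    and "\<And>x. x \<in> carrier L \<Longrightarrow> k (\<theta> `` {x}) = h x"
proof -
  \<comment> \<open>The representative is picked by choice, and the restriction places
    \<open>k\<close> in the extensional function space.\<close>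
  define k where "k = (\<lambda>X\<in>carrier (sup_quotient L \<theta>). h (SOME x. x \<in> X))"
  have k: "k (\<theta> `` {x}) = h x" if x: "x \<in> carrier L" for x
  proof -
    have "equiv (carrier L) \<theta>" using \<theta> by (simp add: sup_congruence_def)
    then have "x \<in> \<theta> `` {x}" using x by (rule equiv_class_self)
    then have "(SOME y. y \<in> \<theta> `` {x}) \<in> \<theta> `` {x}" by (rule someI)
    \<comment> \<open>The chosen representative need not be \<open>x\<close>, but it is congruent to
      \<open>x\<close>, and \<open>le\<close> asks for no more.\<close>
    then have "h x = h (SOME y. y \<in> \<theta> `` {x})" by (intro le) (simp only: Image_singleton_iff)
    moreover have "\<theta> `` {x} \<in> carrier (sup_quotient L \<theta>)"
      using x by (simp add: sup_quotient_carrier)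
    ultimately show ?thesis unfolding k_def by (simp only: restrict_apply')
  qed
  have closed: "k X \<in> carrier K" if "X \<in> carrier (sup_quotient L \<theta>)" for X
    using that k sup_hom_closed[OF h] by (auto simp: sup_quotient_carrier)
  have "k \<in> sup_hom (sup_quotient L \<theta>) K"
  proof (rule sup_homI)
    fix B assume "B \<subseteq> carrier (sup_quotient L \<theta>)"
    \<comment> \<open>Any set of classes is the image of a set of representatives, so the formula
      for joins in the quotient applies.\<close>
    then obtain A where A: "A \<subseteq> carrier L" and B: "B = (\<lambda>x. \<theta> `` {x}) ` A"
      unfolding sup_quotient_carrier by (meson subset_imageE)
    have "k ` B = h ` A"
      unfolding B image_image using A k by (intro image_cong) auto
    then show "k (\<Squnion>\<^bsub>sup_quotient L \<theta>\<^esub>B) = \<Squnion>\<^bsub>K\<^esub>(k ` B)"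
      unfolding B
      by (simp add: sup_quotient_join(2)[OF L \<theta> A] k sup_lattice.sup_carrier[OF L A]
          sup_hom_sup[OF h A])
  qed (rule closed)
  moreover have "k \<in> carrier (sup_quotient L \<theta>) \<rightarrow>\<^sub>E carrier K"
    using closed by (auto simp: k_def)
  ultimately show thesis using k that by blast
qed

section \<open>The powerset as a free sup-lattice\<close>

lemma powerset_carrier [simp]: "carrier (powerset_lattice X) = Pow X"
  by (simp add: powerset_lattice_def)

text \<open>This is the existence half of freeness. Joins in the powerset are unions, so
  \<open>sup_Union\<close>, applied to the family of images under \<open>f\<close>, gives
  preservation of joins.\<close>

lemma sup_hom_powerset_extend:
  assumes K: "sup_lattice K" and f: "f \<in> X \<rightarrow> carrier K"
  shows "(\<lambda>S. \<Squnion>\<^bsub>K\<^esub>(f ` S)) \<in> sup_hom (powerset_lattice X) K"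
proof (rule sup_homI)
  interpret K: sup_lattice K by (rule K)
  show "\<Squnion>\<^bsub>K\<^esub>(f ` S) \<in> carrier K" if "S \<in> carrier (powerset_lattice X)" for S
    using that f by (intro K.sup_carrier) auto
  fix \<A> assume "\<A> \<subseteq> carrier (powerset_lattice X)"
  then have \<A>: "\<A> \<subseteq> Pow X" by simp
  then have "(`) f ` \<A> \<subseteq> Pow (carrier K)" using f by blast
  from K.sup_Union[OF this]
  show "\<Squnion>\<^bsub>K\<^esub>(f ` (\<Squnion>\<^bsub>powerset_lattice X\<^esub>\<A>)) = \<Squnion>\<^bsub>K\<^esub>((\<lambda>S. \<Squnion>\<^bsub>K\<^esub>(f ` S)) ` \<A>)"
    by (simp add: powerset_join[OF \<A>] image_Union image_image)
qed

section \<open>Bimorphisms and uniqueness of the tensor product\<close>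

lemma bimorphismD:
  assumes "bimorphism Q M1 M2 L f"
  shows "f \<in> carrier M1 \<times> carrier M2 \<rightarrow> carrier L"
    and "\<And>A y. A \<subseteq> carrier M1 \<Longrightarrow> y \<in> carrier M2 \<Longrightarrow>
      f (\<Squnion>\<^bsub>M1\<^esub>A, y) = \<Squnion>\<^bsub>L\<^esub>((\<lambda>a. f (a, y)) ` A)"
    and "\<And>x B. x \<in> carrier M1 \<Longrightarrow> B \<subseteq> carrier M2 \<Longrightarrow>
      f (x, \<Squnion>\<^bsub>M2\<^esub>B) = \<Squnion>\<^bsub>L\<^esub>((\<lambda>b. f (x, b)) ` B)"
    and "\<And>x q y. x \<in> carrier M1 \<Longrightarrow> q \<in> carrier Q \<Longrightarrow> y \<in> carrier M2 \<Longrightarrow>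
      f (ract M1 x q, y) = f (x, lact M2 q y)"
  using assms by (auto simp: bimorphism_def)

lemma is_tensor_productD:
  fixes L :: "'l gorder"
  assumes "is_tensor_product TYPE('l) Q M1 M2 T \<tau>"
  shows "sup_lattice T" and "bimorphism Q M1 M2 T \<tau>"
    and "sup_lattice L \<Longrightarrow> bimorphism Q M1 M2 L f \<Longrightarrow>
      \<exists>!k. k \<in> carrier T \<rightarrow>\<^sub>E carrier L \<and> k \<in> sup_hom T L \<and>
        (\<forall>p \<in> carrier M1 \<times> carrier M2. k (\<tau> p) = f p)"
  using assms by (auto simp: is_tensor_product_def)

text \<open>With \<tau> itself as the test bimorphism, both \<open>g\<close> and the identity solve
  the universal problem, so uniqueness identifies them on \<open>carrier T\<close>.\<close>

lemma tensor_product_endo_id: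
  fixes T :: "'t gorder"
  assumes T: "is_tensor_product TYPE('t) Q M1 M2 T \<tau>"
    and g: "g \<in> sup_hom T T" and fixed: "\<And>p. p \<in> carrier M1 \<times> carrier M2 \<Longrightarrow> g (\<tau> p) = \<tau> p"
    and x: "x \<in> carrier T"
  shows "g x = x"
proof -
  note lat = is_tensor_productD(1)[OF T] and bi = is_tensor_productD(2)[OF T]
  let ?P = "\<lambda>k. k \<in> carrier T \<rightarrow>\<^sub>E carrier T \<and> k \<in> sup_hom T T \<and>
    (\<forall>p \<in> carrier M1 \<times> carrier M2. k (\<tau> p) = \<tau> p)"
  have \<tau>: "\<tau> p \<in> carrier T" if "p \<in> carrier M1 \<times> carrier M2" for p
    using bimorphismD(1)[OF bi] that by blast
  \<comment> \<open>Uniqueness is stated for extensional functions, so \<open>g\<close> and the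
    identity are compared after restriction; each \<open>\<tau> p\<close> lies in the carrier, hence
    its value is unchanged.\<close>
  have "?P (restrict h (carrier T))"
    if h: "h \<in> sup_hom T T" and "\<And>p. p \<in> carrier M1 \<times> carrier M2 \<Longrightarrow> h (\<tau> p) = \<tau> p" for h
    using that(2) \<tau> sup_hom_closed[OF h] sup_hom_cong[OF h lat, of "restrict h (carrier T)"]
    by simp
  from this[OF g fixed] this[OF sup_hom_id]
  have P: "?P (restrict g (carrier T))" "?P (restrict (\<lambda>x. x) (carrier T))" by simp_all
  obtain u where u: "\<And>k. ?P k \<Longrightarrow> k = u"
    using is_tensor_productD(3)[OF T lat bi] by (elim ex1E) blast
  have "restrict g (carrier T) = restrict (\<lambda>x. x) (carrier T)"
    using u[OF P(1)] u[OF P(2)] by simp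
  then show ?thesis using x by (metis restrict_apply')
qed

text \<open>The universal properties give maps in both directions whose composites fix the universal
  bimorphisms, hence are identities. There are four assumptions because the test type is a
  parameter: \<open>St\<close> and \<open>Ts\<close> yield the two maps, \<open>Ss\<close> and
  \<open>Tt\<close> control the composites.\<close>

lemma tensor_product_unique:
  fixes S :: "'s gorder" and T :: "'t gorder"
  assumes Ss: "is_tensor_product TYPE('s) Q M1 M2 S \<sigma>"
    and St: "is_tensor_product TYPE('t) Q M1 M2 S \<sigma>"
    and Ts: "is_tensor_product TYPE('s) Q M1 M2 T \<tau>"
    and Tt: "is_tensor_product TYPE('t) Q M1 M2 T \<tau>"
  shows "\<exists>\<phi> \<in> sup_iso S T. \<forall>p \<in> carrier M1 \<times> carrier M2. \<phi> (\<sigma> p) = \<tau> p"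
proof -
  note S = is_tensor_productD(1,2)[OF Ss] and T = is_tensor_productD(1,2)[OF Tt]
  obtain k where k: "k \<in> sup_hom S T" "\<forall>p \<in> carrier M1 \<times> carrier M2. k (\<sigma> p) = \<tau> p"
    using is_tensor_productD(3)[OF St T] by blast
  obtain j where j: "j \<in> sup_hom T S" "\<forall>p \<in> carrier M1 \<times> carrier M2. j (\<tau> p) = \<sigma> p"
    using is_tensor_productD(3)[OF Ts S] by blast
  have "j (k x) = x" if "x \<in> carrier S" for x
    using tensor_product_endo_id[OF Ss sup_hom_compose[OF k(1) j(1)] _ that] k(2) j(2) by simp
  moreover have "k (j y) = y" if "y \<in> carrier T" for y
    using tensor_product_endo_id[OF Tt sup_hom_compose[OF j(1) k(1)] _ that] k(2) j(2) by simp
  ultimately have "bij_betw k (carrier S) (carrier T)"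
    using sup_hom_closed[OF k(1)] sup_hom_closed[OF j(1)]
    by (intro bij_betw_byWitness[where f' = j]) auto
  then show ?thesis using k by (auto simp: sup_iso_def)
qed

section \<open>The powerset quotient as a tensor product\<close>

context
  fixes Q :: "'q quantale"
    and M1 :: "('q, 'a) right_qmodule"
    and M2 :: "('q, 'b) left_qmodule"
  assumes M1: "right_qmodule Q M1"
    and M2: "left_qmodule Q M2"
begin

interpretation M1: right_qmodule Q M1 by (rule M1)
interpretation M2: left_qmodule Q M2 by (rule M2)

private abbreviation (input) X where "X \<equiv> carrier M1 \<times> carrier M2"
private abbreviation (input) \<theta> where "\<theta> \<equiv> tensor_congruence Q M1 M2"
private abbreviation (input) T where "T \<equiv> tensor_quotient Q M1 M2"

lemma tensor_relation_carrier: "tensor_relation Q M1 M2 \<subseteq> Pow X \<times> Pow X"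
  unfolding tensor_relation_def
  by (auto simp: M1.ract_closed M2.lact_closed)

lemma sup_congruence_tensor: "sup_congruence (powerset_lattice X) \<theta>"
  unfolding tensor_congruence_def
  using tensor_relation_carrier by (intro sup_congruence_generated sup_lattice_powerset) simp

lemmas tensor_quotient_join =
  sup_quotient_join[OF sup_lattice_powerset sup_congruence_tensor, folded tensor_quotient_def]

lemma tensor_class_eq:
  "(S, S') \<in> tensor_relation Q M1 M2 \<Longrightarrow> \<theta> `` {S} = \<theta> `` {S'}"
  using sup_congruence_tensor generated_sup_congruence_incl
  unfolding sup_congruence_def tensor_congruence_def by (meson equiv_class_eq subsetD)

text \<open>A set is the union of its singletons, and passing to classes preserves joins. So the
  images of \<open>tensor_map\<close> generate the quotient under joins, which later forces
  uniqueness.\<close>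

lemma tensor_class_join:
  assumes "S \<subseteq> X"
  shows "\<theta> `` {S} = \<Squnion>\<^bsub>T\<^esub>(tensor_map Q M1 M2 ` S)"
proof -
  have sub: "(\<lambda>p. {p}) ` S \<subseteq> Pow X" using assms by auto
  then have "\<Squnion>\<^bsub>T\<^esub>(tensor_map Q M1 M2 ` S) = \<theta> `` {\<Squnion>\<^bsub>powerset_lattice X\<^esub>((\<lambda>p. {p}) ` S)}"
    using tensor_quotient_join(2)[of "(\<lambda>p. {p}) ` S"]
    by (simp add: tensor_map_def[abs_def] image_image)
  then show ?thesis by (simp add: powerset_join[OF sub])
qed

text \<open>Each of the three forms of generating pairs becomes an equality of classes; for the two
  join laws, \<open>tensor_class_join\<close> turns the class of the right-hand set into a
  join.\<close>

lemma bimorphism_tensor_map: "bimorphism Q M1 M2 T (tensor_map Q M1 M2)"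
  unfolding bimorphism_def
proof (intro conjI allI impI ballI)
  show "tensor_map Q M1 M2 \<in> X \<rightarrow> carrier T"
    by (auto simp: tensor_map_def tensor_quotient_def sup_quotient_carrier)
next
  fix A y assume A: "A \<subseteq> carrier M1" and y: "y \<in> carrier M2"
  then have "tensor_map Q M1 M2 (\<Squnion>\<^bsub>M1\<^esub>A, y) = \<theta> `` {\<Union>a\<in>A. {(a, y)}}"
    unfolding tensor_map_def by (intro tensor_class_eq) (auto simp: tensor_relation_def)
  also have "\<dots> = \<Squnion>\<^bsub>T\<^esub>(tensor_map Q M1 M2 ` (\<Union>a\<in>A. {(a, y)}))"
    using A y by (intro tensor_class_join) auto
  finally show "tensor_map Q M1 M2 (\<Squnion>\<^bsub>M1\<^esub>A, y) = \<Squnion>\<^bsub>T\<^esub>((\<lambda>a. tensor_map Q M1 M2 (a, y)) ` A)"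
    by (simp add: UNION_singleton_eq_range image_image)
next
  fix x B assume x: "x \<in> carrier M1" and B: "B \<subseteq> carrier M2"
  then have "tensor_map Q M1 M2 (x, \<Squnion>\<^bsub>M2\<^esub>B) = \<theta> `` {\<Union>b\<in>B. {(x, b)}}"
    unfolding tensor_map_def by (intro tensor_class_eq) (auto simp: tensor_relation_def)
  also have "\<dots> = \<Squnion>\<^bsub>T\<^esub>(tensor_map Q M1 M2 ` (\<Union>b\<in>B. {(x, b)}))"
    using x B by (intro tensor_class_join) auto
  finally show "tensor_map Q M1 M2 (x, \<Squnion>\<^bsub>M2\<^esub>B) = \<Squnion>\<^bsub>T\<^esub>((\<lambda>b. tensor_map Q M1 M2 (x, b)) ` B)"
    by (simp add: UNION_singleton_eq_range image_image)
next
  fix x q y assume "x \<in> carrier M1" "q \<in> carrier Q" "y \<in> carrier M2"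
  then show "tensor_map Q M1 M2 (ract M1 x q, y) = tensor_map Q M1 M2 (x, lact M2 q y)"
    unfolding tensor_map_def by (intro tensor_class_eq) (auto simp: tensor_relation_def)
qed

lemma bimorphism_tensor_congruence:
  assumes L: "sup_lattice L" and f: "bimorphism Q M1 M2 L f" and SS': "(S, S') \<in> \<theta>"
  shows "\<Squnion>\<^bsub>L\<^esub>(f ` S) = \<Squnion>\<^bsub>L\<^esub>(f ` S')"
proof -
  interpret L: sup_lattice L by (rule L)
  note fc = bimorphismD(1)[OF f]
  \<comment> \<open>This is the kernel of the extension of \<open>f\<close> to the powerset, spelled
    out so that leastness of the generated congruence applies.\<close>
  let ?K = "{(S, S') \<in> carrier (powerset_lattice X) \<times> carrier (powerset_lattice X).
    \<Squnion>\<^bsub>L\<^esub>(f ` S) = \<Squnion>\<^bsub>L\<^esub>(f ` S')}"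
  \<comment> \<open>The extension agrees with \<open>f\<close> on singletons, so on the first two
    kinds of generators the claim is the matching bimorphism law.\<close>
  have single: "\<Squnion>\<^bsub>L\<^esub>(f ` {p}) = f p" if "p \<in> X" for p
    using L.sup_singleton[OF funcset_mem[OF fc that]] by simp
  have "\<Squnion>\<^bsub>L\<^esub>(f ` S) = \<Squnion>\<^bsub>L\<^esub>(f ` S')" if SS': "(S, S') \<in> tensor_relation Q M1 M2" for S S'
    using SS' unfolding tensor_relation_def
  proof (elim UnE CollectE exE conjE Pair_inject)
    fix A y assume A: "A \<subseteq> carrier M1" and y: "y \<in> carrier M2"
      and S: "S = {(\<Squnion>\<^bsub>M1\<^esub>A, y)}" "S' = (\<Union>a\<in>A. {(a, y)})"
    have "(\<Squnion>\<^bsub>M1\<^esub>A, y) \<in> X" using A y by auto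
    then show ?thesis
      unfolding S by (simp only: single bimorphismD(2)[OF f A y])
        (simp add: UNION_singleton_eq_range image_image)
  next
    fix x B assume x: "x \<in> carrier M1" and B: "B \<subseteq> carrier M2"
      and S: "S = {(x, \<Squnion>\<^bsub>M2\<^esub>B)}" "S' = (\<Union>b\<in>B. {(x, b)})"
    have "(x, \<Squnion>\<^bsub>M2\<^esub>B) \<in> X" using x B by auto
    then show ?thesis
      unfolding S by (simp only: single bimorphismD(3)[OF f x B])
        (simp add: UNION_singleton_eq_range image_image)
  next
    fix x q y assume "x \<in> carrier M1" "q \<in> carrier Q" "y \<in> carrier M2"
      and "S = {(ract M1 x q, y)}" "S' = {(x, lact M2 q y)}"
    then show ?thesis using bimorphismD(4)[OF f] by simp
  qed
  then have "tensor_relation Q M1 M2 \<subseteq> ?K" using tensor_relation_carrier by auto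
  then have "\<theta> \<subseteq> ?K"
    unfolding tensor_congruence_def
    using sup_congruence_kernel[OF sup_lattice_powerset sup_hom_powerset_extend[OF L fc]]
    by (intro generated_sup_congruence_least)
  then show ?thesis using SS' by blast
qed

lemma is_tensor_product_quotient:
  "is_tensor_product TYPE('l) Q M1 M2 T (tensor_map Q M1 M2)"
  unfolding is_tensor_product_def
proof (intro conjI allI impI)
  show "sup_lattice T" by (rule tensor_quotient_join(1))
  show "bimorphism Q M1 M2 T (tensor_map Q M1 M2)" by (rule bimorphism_tensor_map)
  fix L :: "'l gorder" and f
  assume L: "sup_lattice L" and f: "bimorphism Q M1 M2 L f"
  interpret L: sup_lattice L by (rule L)
  note fc = bimorphismD(1)[OF f]
  obtain k where k: "k \<in> carrier T \<rightarrow>\<^sub>E carrier L" "k \<in> sup_hom T L"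
    and kS: "\<And>S. S \<in> carrier (powerset_lattice X) \<Longrightarrow> k (\<theta> `` {S}) = \<Squnion>\<^bsub>L\<^esub>(f ` S)"
    using sup_quotient_factor[OF sup_lattice_powerset sup_congruence_tensor
        sup_hom_powerset_extend[OF L fc] bimorphism_tensor_congruence[OF L f]]
    unfolding tensor_quotient_def by blast
  have k\<tau>: "k (tensor_map Q M1 M2 p) = f p" if p: "p \<in> X" for p
    using kS[of "{p}"] p L.sup_singleton[OF funcset_mem[OF fc p]]
    by (simp add: tensor_map_def)
  show "\<exists>!k. k \<in> carrier T \<rightarrow>\<^sub>E carrier L \<and> k \<in> sup_hom T L \<and>
    (\<forall>p\<in>X. k (tensor_map Q M1 M2 p) = f p)"
  proof (intro ex1I[of _ k] conjI ballI k k\<tau>, assumption)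
    fix j assume j: "j \<in> carrier T \<rightarrow>\<^sub>E carrier L \<and> j \<in> sup_hom T L \<and>
      (\<forall>p\<in>X. j (tensor_map Q M1 M2 p) = f p)"
    show "j = k"
    proof (rule PiE_ext)
      fix Y assume "Y \<in> carrier T"
      then obtain S where S: "S \<subseteq> X" "Y = \<theta> `` {S}"
        by (auto simp: tensor_quotient_def sup_quotient_carrier)
      have "tensor_map Q M1 M2 ` S \<subseteq> carrier T"
        using bimorphismD(1)[OF bimorphism_tensor_map] S(1) by blast
      \<comment> \<open>Writing the class \<open>Y\<close> as a join of images of
        \<open>tensor_map\<close> leaves \<open>j\<close> no freedom: its values there are those of
        \<open>f\<close>.\<close>
      then have "j Y = \<Squnion>\<^bsub>L\<^esub>(j ` tensor_map Q M1 M2 ` S)"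
        using j by (simp add: S tensor_class_join sup_hom_sup)
      also have "j ` tensor_map Q M1 M2 ` S = f ` S"
        unfolding image_image using j S(1) by (intro image_cong) auto
      finally show "j Y = k Y" using kS S by simp
    qed (use j k in auto)
  qed
qed

end

text \<open>The universal property of the quotient is proved for an arbitrary test type, so it is
  available both at \<open>'t\<close> and at the quotient's own type. For a competitor
  \<open>T\<close>, testing at the quotient's type gives the map back to the quotient, and testing
  at \<open>'t\<close> shows that the composite on \<open>T\<close> is the identity.\<close>

theorem theorem4p7p2:
  fixes Q :: "'q quantale"
    and M1 :: "('q, 'a) right_qmodule"
    and M2 :: "('q, 'b) left_qmodule"
  assumes "quantale Q"
    and "right_qmodule Q M1"
    and "left_qmodule Q M2"
  shows "is_tensor_product TYPE('l) Q M1 M2 (tensor_quotient Q M1 M2) (tensor_map Q M1 M2) \<and>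
    (\<forall>(T :: 't gorder) \<tau>.
      is_tensor_product TYPE('t) Q M1 M2 T \<tau> \<longrightarrow>
      is_tensor_product TYPE(('a \<times> 'b) set set) Q M1 M2 T \<tau> \<longrightarrow>
      (\<exists>\<phi> \<in> sup_iso (tensor_quotient Q M1 M2) T.
        \<forall>p \<in> carrier M1 \<times> carrier M2. \<phi> (tensor_map Q M1 M2 p) = \<tau> p))"
  using assms(2,3) by (blast intro: tensor_product_unique is_tensor_product_quotient)

end
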